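(* Let $f \in \mathcal{P}^{*}$ and let $\gamma_1,\gamma_2$ be the first two logarithmic coefficients of $f$. Then $$-\frac12\le |\gamma_2|-|\gamma_1|\le \frac13.$$ The inequalities are sharp: for each of the two inequalities there is a function in $\mathcal{P}^{*}$ for which equality holds.
   Context: Let $\mathbb{D}=\{z\in\mathbb{C}:|z|<1\}$. $\mathcal{S}$ is the class of functions $f$ that are analytic and univalent (injective) in $\mathbb{D}$ with expansion $f(z)=z+\sum_{n\ge 2}a_n z^n$. A Schwarz function is an analytic $\omega:\mathbb{D}\to\mathbb{C}$ with $\omega(0)=0$ and $|\omega(z)|<1$ for all $z\in\mathbb{D}$. For $g,h$ analytic in $\mathbb{D}$, $g\prec h$ ($g$ is subordinate to $h$) means that there is a Schwarz function $\omega$ with $g(z)=h(\omega(z))$ for all $z\in\mathbb{D}$. The class $\mathcal{P}^{*}$ is $$\mathcal{P}^{*}=\{f\in\mathcal{S}: f'(z)\prec e^{z}(1+\sin z),\ z\in\mathbb{D}\}.$$ The logarithmic coefficients $\gamma_n$ of $f\in\mathcal{S}$ are defined by $\log\frac{f(z)}{z}=2\sum_{n=1}^{\infty}\gamma_n z^n$, $z\in\mathbb{D}$ (branch of the logarithm vanishing at $z=0$). Explicitly, $\gamma_1=\tfrac12 a_2$ and $\gamma_2=\tfrac12\left(a_3-\tfrac12a_2^2\right)$. *)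

theory Defs
  imports "HOL-Complex_Analysis.Complex_Analysis"
begin

text \<open>
  Functions on the unit disc are represented by total functions on the complex numbers; only
  their values on \<open>ball 0 1\<close> matter.
\<close>

definition class_S :: "(complex \<Rightarrow> complex) set" where
  "class_S = {f. f holomorphic_on ball 0 1 \<and> inj_on f (ball 0 1) \<and>
     (\<exists>a :: nat \<Rightarrow> complex. a 0 = 0 \<and> a 1 = 1 \<and>
        (\<forall>z\<in>ball 0 1. (\<lambda>n. a n * z ^ n) sums f z))}"

definition schwarz_function :: "(complex \<Rightarrow> complex) \<Rightarrow> bool" where
  "schwarz_function \<omega> \<longleftrightarrow> \<omega> holomorphic_on ball 0 1 \<and> \<omega> 0 = 0 \<and>
     (\<forall>z\<in>ball 0 1. norm (\<omega> z) < 1)"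

definition subordinate :: "(complex \<Rightarrow> complex) \<Rightarrow> (complex \<Rightarrow> complex) \<Rightarrow> bool" where
  "subordinate g h \<longleftrightarrow> g holomorphic_on ball 0 1 \<and> h holomorphic_on ball 0 1 \<and>
     (\<exists>\<omega>. schwarz_function \<omega> \<and> (\<forall>z\<in>ball 0 1. g z = h (\<omega> z)))"

definition class_P_star :: "(complex \<Rightarrow> complex) set" where
  "class_P_star = {f \<in> class_S. subordinate (deriv f) (\<lambda>z. exp z * (1 + sin z))}"

text \<open>
  The function \<open>L\<close> below is the analytic branch of \<open>log (f z / z)\<close> on the unit disc that
  vanishes at \<open>0\<close>. The point \<open>0\<close>, where the quotient has a removable singularity with
  value \<open>1\<close>, is excluded from the defining equation because \<open>f 0 / 0 = 0\<close> in HOL.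
  The series starts at index 1, so the value at index 0 is fixed to be 0 by convention. The
  description operator is justified by the lemma \<open>ex1_is_log_coeffs\<close>.
\<close>

definition is_log_coeffs :: "(complex \<Rightarrow> complex) \<Rightarrow> (nat \<Rightarrow> complex) \<Rightarrow> bool" where
  "is_log_coeffs f \<gamma> \<longleftrightarrow> \<gamma> 0 = 0 \<and>
     (\<exists>L. L holomorphic_on ball 0 1 \<and> L 0 = 0 \<and>
        (\<forall>z\<in>ball 0 1 - {0}. exp (L z) = f z / z) \<and>
        (\<forall>z\<in>ball 0 1. (\<lambda>n. 2 * (\<gamma> (Suc n) * z ^ Suc n)) sums L z))"

definition log_coeff :: "(complex \<Rightarrow> complex) \<Rightarrow> nat \<Rightarrow> complex" where
  "log_coeff f = (THE \<gamma>. is_log_coeffs f \<gamma>)"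

lemma class_S_zero:
  assumes "f \<in> class_S"
  shows "f 0 = 0"
proof -
  obtain a :: "nat \<Rightarrow> complex" where a: "a 0 = 0" "\<forall>z\<in>ball 0 1. (\<lambda>n. a n * z ^ n) sums f z"
    using assms unfolding class_S_def by blast
  have "(\<lambda>n. a n * 0 ^ n) sums f 0"
    by (rule bspec[OF a(2)]) simp
  then show ?thesis
    using a(1) by (simp only: powser_sums_zero_iff)
qed

lemma class_S_deriv_zero:
  assumes "f \<in> class_S"
  shows "deriv f 0 = 1"
proof -
  obtain a :: "nat \<Rightarrow> complex" where a: "a 1 = 1" "\<forall>z\<in>ball 0 1. (\<lambda>n. a n * z ^ n) sums f z"
    using assms unfolding class_S_def by blast
  have "f holomorphic_on ball 0 1"
    using assms by (simp add: class_S_def)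
  then have "(f has_field_derivative deriv f 0) (at 0)"
    by (rule holomorphic_derivI) auto
  then have "(\<lambda>n. diffs a n * 0 ^ n) sums deriv f 0"
    by (rule termdiffs_sums_strong[where K = 1, rotated]) (use a in auto)
  then show ?thesis
    using a(1) by (simp only: powser_sums_zero_iff) (simp add: diffs_def)
qed

lemma ex_is_log_coeffs:
  assumes f: "f \<in> class_S"
  shows "\<exists>\<gamma>. is_log_coeffs f \<gamma>"
proof -
  define g where "g = (\<lambda>z. if z = 0 then deriv f 0 else f z / z)"
  have hf: "f holomorphic_on ball 0 1" and inj: "inj_on f (ball 0 1)"
    using f by (auto simp: class_S_def)
  have "(\<lambda>z. if z = 0 then deriv f 0 else (f z - f 0) / (z - 0)) holomorphic_on ball 0 1"
    by (rule pole_lemma) (use hf in auto)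
  then have hg: "g holomorphic_on ball 0 1"
    by (simp add: g_def class_S_zero[OF f] cong: if_cong)
  have g0: "g z \<noteq> 0" if "z \<in> ball 0 1" for z
  proof (cases "z = 0")
    case True
    then show ?thesis by (simp add: g_def class_S_deriv_zero[OF f])
  next
    case False
    then have "f z \<noteq> f 0"
      using inj that by (auto dest: inj_onD)
    then show ?thesis
      using False by (simp add: g_def class_S_zero[OF f])
  qed
  obtain M where M: "M holomorphic_on ball 0 1" "\<And>z. z \<in> ball 0 1 \<Longrightarrow> g z = exp (M z)"
    using contractible_imp_holomorphic_log[OF hg _ g0] convex_imp_contractible convex_ball by blast
  define L where "L = (\<lambda>z. M z - M 0)"
  have hL: "L holomorphic_on ball 0 1"
    unfolding L_def by (intro holomorphic_intros M)
  have L0: "L 0 = 0"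
    by (simp add: L_def)
  have M0: "exp (M 0) = 1"
    using M(2)[of 0] by (simp add: g_def class_S_deriv_zero[OF f])
  have eL: "exp (L z) = f z / z" if "z \<in> ball 0 1 - {0}" for z
    using M(2)[of z] that M0 by (simp add: L_def exp_diff g_def)
  define \<gamma> where "\<gamma> = (\<lambda>n. (deriv ^^ n) L 0 / fact n / 2)"
  have g00: "\<gamma> 0 = 0"
    by (simp add: \<gamma>_def L_def)
  have "(\<lambda>n. 2 * (\<gamma> (Suc n) * z ^ Suc n)) sums L z" if "z \<in> ball 0 1" for z
  proof -
    have "(\<lambda>n. 2 * (\<gamma> n * z ^ n)) sums L z"
      using holomorphic_power_series[OF hL that] by (simp add: \<gamma>_def)
    then show ?thesis
      using g00 by (subst sums_Suc_iff) simp
  qed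
  then show ?thesis
    using g00 hL eL L0 unfolding is_log_coeffs_def by blast
qed

lemma is_log_coeffs_unique:
  assumes "is_log_coeffs f \<gamma>" "is_log_coeffs f \<delta>"
  shows "\<gamma> = \<delta>"
proof -
  obtain L where L: "\<gamma> 0 = 0" "L holomorphic_on ball 0 1" "L 0 = 0"
    "\<And>z. z \<in> ball 0 1 - {0} \<Longrightarrow> exp (L z) = f z / z"
    "\<And>z. z \<in> ball 0 1 \<Longrightarrow> (\<lambda>n. 2 * (\<gamma> (Suc n) * z ^ Suc n)) sums L z"
    using assms(1) unfolding is_log_coeffs_def by blast
  obtain K where K: "\<delta> 0 = 0" "K holomorphic_on ball 0 1" "K 0 = 0"
    "\<And>z. z \<in> ball 0 1 - {0} \<Longrightarrow> exp (K z) = f z / z"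
    "\<And>z. z \<in> ball 0 1 \<Longrightarrow> (\<lambda>n. 2 * (\<delta> (Suc n) * z ^ Suc n)) sums K z"
    using assms(2) unfolding is_log_coeffs_def by blast
  define D where "D = (\<lambda>z. L z - K z)"
  have hD: "D holomorphic_on ball 0 1"
    unfolding D_def by (intro holomorphic_intros L K)
  have eD: "exp (D z) = 1" if "z \<in> ball 0 1" for z
  proof (cases "z = 0")
    case True
    then show ?thesis by (simp add: D_def L K)
  next
    case False
    then have "exp (L z) = exp (K z)"
      using that L(4) K(4) by simp
    then show ?thesis by (simp add: D_def exp_diff)
  qed
  have "deriv D z = 0" if z: "z \<in> ball 0 1" for z
  proof -
    have "(D has_field_derivative deriv D z) (at z)"
      using hD z by (simp add: holomorphic_derivI)
    then have "((\<lambda>w. exp (D w)) has_field_derivative exp (D z) * deriv D z) (at z)"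
      by (rule DERIV_fun_exp)
    moreover have "((\<lambda>w. exp (D w)) has_field_derivative 0) (at z)"
      by (rule has_field_derivative_transform_within_open[where f = "\<lambda>_. 1" and S = "ball 0 1"])
        (use z eD in auto)
    ultimately show ?thesis
      using DERIV_unique eD[OF z] by fastforce
  qed
  then have D0: "D z = 0" if "z \<in> ball 0 1" for z
  proof -
    obtain c where c: "\<And>w. w \<in> ball 0 1 \<Longrightarrow> D w = c"
      using has_field_derivative_zero_constant[of "ball 0 1" D] hD \<open>\<And>z. z \<in> ball 0 1 \<Longrightarrow> deriv D z = 0\<close>
      by (metis convex_ball holomorphic_derivI open_ball)
    then show ?thesis
      using c[of 0] that by (simp add: D_def L K)
  qed
  have s: "(\<lambda>n. (2 * (\<gamma> n - \<delta> n)) * (z - 0) ^ n) sums 0" if z: "norm z < 1" for z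
  proof -
    have "(\<lambda>n. 2 * (\<gamma> (Suc n) * z ^ Suc n) - 2 * (\<delta> (Suc n) * z ^ Suc n)) sums 0"
      using sums_diff[OF L(5)[of z] K(5)[of z]] D0[of z] z by (simp add: D_def)
    then have "(\<lambda>n. (2 * (\<gamma> (Suc n) - \<delta> (Suc n))) * (z - 0) ^ Suc n) sums 0"
      by (simp add: algebra_simps)
    then show ?thesis
      using L(1) K(1) by (subst (asm) sums_Suc_iff) simp
  qed
  show ?thesis
  proof (rule ccontr)
    assume "\<gamma> \<noteq> \<delta>"
    then obtain n where n: "2 * (\<gamma> n - \<delta> n) \<noteq> 0"
      by auto
    then have "n > 0"
      using L(1) K(1) by (cases n) auto
    show False
    proof (rule powser_0_nonzero[of 1 0 "\<lambda>n. 2 * (\<gamma> n - \<delta> n)" "\<lambda>_. 0 :: complex" n])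
      fix r :: real
      assume r: "r > 0" and nz: "\<And>z. z \<in> cball (0::complex) r - {0} \<Longrightarrow> (0::complex) \<noteq> 0"
      show False
        using nz[of "complex_of_real r"] r by simp
    qed (use s n \<open>n > 0\<close> in simp_all)
  qed
qed

lemma ex1_is_log_coeffs: "f \<in> class_S \<Longrightarrow> \<exists>!\<gamma>. is_log_coeffs f \<gamma>"
  using ex_is_log_coeffs is_log_coeffs_unique by blast

lemma is_log_coeffs_log_coeff: "f \<in> class_S \<Longrightarrow> is_log_coeffs f (log_coeff f)"
  unfolding log_coeff_def by (rule theI'[OF ex1_is_log_coeffs])

end

theory Submission
  imports Defs
begin

text \<open>
  Let \<open>f' = \<phi> \<circ> \<omega>\<close> with \<open>\<phi> z = exp z * (1 + sin z) = 1 + 2 z + 3/2 z\<^sup>2 + \<dots>\<close> and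
  \<open>\<omega> z = c\<^sub>1 z + c\<^sub>2 z\<^sup>2 + \<dots>\<close>. Comparing coefficients gives \<open>\<gamma>\<^sub>1 = c\<^sub>1 / 2\<close> and
  \<open>\<gamma>\<^sub>2 = c\<^sub>2 / 3\<close>: the particular value \<open>3/2\<close> of the second coefficient of \<open>\<phi>\<close> makes the
  \<open>c\<^sub>1\<^sup>2\<close> terms cancel (lemma \<open>log_coeffs_eq\<close>). Hence
  \<open>\<bar>\<gamma>\<^sub>2\<bar> - \<bar>\<gamma>\<^sub>1\<bar> = \<bar>c\<^sub>2\<bar> / 3 - \<bar>c\<^sub>1\<bar> / 2\<close>, and both bounds follow from the Cauchy estimates
  \<open>\<bar>c\<^sub>1\<bar> \<le> 1\<close> and \<open>\<bar>c\<^sub>2\<bar> \<le> 1\<close>.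

  Equality is attained for \<open>\<omega> z = z\<close> (lower bound) and \<open>\<omega> z = z\<^sup>2\<close> (upper bound). The real work
  is to show that the corresponding primitives \<open>F\<close> of \<open>\<phi> z\<close> and \<open>G\<close> of \<open>\<phi> (z\<^sup>2)\<close> are
  univalent. The argument of \<open>\<phi>\<close> exceeds \<open>\<pi>/2\<close> on the disc, so positivity of the real part of
  the derivative is not available, and \<open>G\<close> is neither starlike nor close-to-convex. Symmetry
  helps: on the closed upper half disc the argument of \<open>\<phi>\<close> stays in an interval shorter than
  \<open>\<pi>\<close>, namely \<open>Re ((1 - 2 i) \<phi>) > 0\<close> (lemma \<open>Re_rotated_phi_pos\<close>). The Noshiro-Warschawski
  argument (lemma \<open>inj_on_convex_if_Re_deriv_pos\<close>) then makes \<open>F\<close> injective on each half disc and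
  \<open>G\<close> injective on each quarter disc, as squaring maps quarter discs into half discs.

  To pass to the whole disc it suffices that the image of \<open>z\<close> determines the piece that contains \<open>z\<close>: the sign of
  \<open>Im F\<close> is that of \<open>Im z\<close>, and the signs of \<open>Im G\<close> and \<open>Re G\<close> are those of \<open>Im z\<close> and
  \<open>Re z\<close> (lemma \<open>sgn_Im_primitive\<close>). For this, \<open>\<phi>\<close> is replaced by its Taylor polynomial of degree
  5, which changes the imaginary part of the primitive by at most \<open>2/125 \<bar>Im z\<bar>\<close>. The primitive
  \<open>P\<close> of the polynomial satisfies \<open>Im P \<ge> Im z / 60\<close> on the upper half disc: by the maximum
  principle this is needed only on the arc, where \<open>Im P / Im z\<close> is a quintic polynomial in one
  real variable whose lower bound is certified by nonnegative Bernstein coefficients. The margin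
  is thin for \<open>Re G\<close>, where the quotient drops to about \<open>0.027\<close>: above \<open>G i\<close> the boundary of the
  image of \<open>G\<close> comes very close to the imaginary axis from both sides.
\<close>

section \<open>Logarithmic coefficients in terms of the Schwarz function\<close>

definition \<phi> :: "complex \<Rightarrow> complex" where
  "\<phi> z = exp z * (1 + sin z)"

lemma DERIV_phi:
  "(\<phi> has_field_derivative exp z * (1 + sin z + cos z)) (at z within S)"
  unfolding \<phi>_def by (auto intro!: derivative_eq_intros simp: algebra_simps)

lemma holomorphic_phi: "\<phi> holomorphic_on S"
  using DERIV_phi by (auto simp: holomorphic_on_def field_differentiable_def)

text \<open>
  Cauchy's estimate on the circle of radius \<open>r < 1\<close>, in the limit \<open>r \<rightarrow> 1\<close>.
\<close>

lemma schwarz_coefficient_bound: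
  assumes "schwarz_function \<omega>"
  shows "norm ((deriv ^^ n) \<omega> 0) \<le> fact n"
proof (rule tendsto_lowerbound)
  have hol: "\<omega> holomorphic_on ball 0 1" and less: "\<And>z. norm z < 1 \<Longrightarrow> norm (\<omega> z) < 1"
    using assms by (auto simp: schwarz_function_def)
  have bound: "norm ((deriv ^^ n) \<omega> 0) \<le> fact n * 1 / r ^ n" if "0 < r" "r < 1" for r
  proof (rule Cauchy_inequality)
    have sub: "cball 0 r \<subseteq> ball (0::complex) 1"
      using that by auto
    show "\<omega> holomorphic_on ball 0 r"
      using hol sub by (meson ball_subset_cball holomorphic_on_subset)
    show "continuous_on (cball 0 r) \<omega>"
      using hol sub by (meson continuous_on_subset holomorphic_on_imp_continuous_on)
  qed (use that less in \<open>auto intro: less_imp_le\<close>)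
  show "eventually (\<lambda>r. norm ((deriv ^^ n) \<omega> 0) \<le> fact n * 1 / r ^ n) (at_left 1)"
    by (rule eventually_at_leftI[of 0]) (use bound in auto)
  show "((\<lambda>r. fact n * 1 / r ^ n) \<longlongrightarrow> fact n) (at_left (1::real))"
    by (auto intro!: tendsto_eq_intros)
qed simp

lemma deriv_eq_if_eq_on_open:
  assumes "open S" "z \<in> S" "\<And>w. w \<in> S \<Longrightarrow> f w = g w"
    and "(f has_field_derivative d) (at z)" "(g has_field_derivative e) (at z)"
  shows "d = e"
proof -
  have "(g has_field_derivative d) (at z)"
    using assms by (intro has_field_derivative_transform_within_open[of f d z S g]) auto
  then show ?thesis
    using assms(5) DERIV_unique by blast
qed

lemma derivs_of_power_series_at_0:
  fixes a :: "nat \<Rightarrow> complex"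
  assumes hol: "L holomorphic_on ball 0 1"
    and sums: "\<And>z. norm z < 1 \<Longrightarrow> (\<lambda>n. a n * z ^ n) sums L z"
  shows "deriv L 0 = a 1" "deriv (deriv L) 0 = 2 * a 2"
proof -
  have 1: "(\<lambda>n. diffs a n * z ^ n) sums deriv L z" if "norm z < 1" for z
    using holomorphic_derivI[OF hol open_ball] that
    by (intro termdiffs_sums_strong[of 1 a L, OF sums]) auto
  have "deriv L holomorphic_on ball 0 1"
    using hol by (simp add: holomorphic_deriv)
  from holomorphic_derivI[OF this open_ball, of 0]
  have 2: "(\<lambda>n. diffs (diffs a) n * 0 ^ n) sums deriv (deriv L) 0"
    by (intro termdiffs_sums_strong[of 1 "diffs a" "deriv L", OF 1]) auto
  show "deriv L 0 = a 1"
    using 1[of 0] by (simp only: powser_sums_zero_iff norm_zero) (simp add: diffs_def)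
  show "deriv (deriv L) 0 = 2 * a 2"
    using 2 by (simp only: powser_sums_zero_iff) (simp add: diffs_def numeral_2_eq_2)
qed

text \<open>
  With \<open>f = z exp L\<close> the subordination reads \<open>exp L * (1 + z L') = \<phi> \<circ> \<omega>\<close>. Its first derivative
  at 0 gives \<open>2 L' = 2 \<omega>'\<close>, the second one \<open>3 L'\<^sup>2 + 3 L'' = 3 \<omega>'\<^sup>2 + 2 \<omega>''\<close>, in which the
  squares cancel.
\<close>

lemma log_coeffs_eq:
  assumes f: "f \<in> class_S" and \<omega>: "schwarz_function \<omega>"
    and sub: "\<And>z. norm z < 1 \<Longrightarrow> deriv f z = \<phi> (\<omega> z)"
  shows "log_coeff f 1 = deriv \<omega> 0 / 2" "log_coeff f 2 = deriv (deriv \<omega>) 0 / 6"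
proof -
  let ?D = "ball (0::complex) 1"
  define \<gamma> where "\<gamma> = log_coeff f"
  obtain L where \<gamma>0: "\<gamma> 0 = 0" and L: "L holomorphic_on ?D" "L 0 = 0"
    and expL: "\<And>z. z \<in> ?D - {0} \<Longrightarrow> exp (L z) = f z / z"
    and sums: "\<And>z. z \<in> ?D \<Longrightarrow> (\<lambda>n. 2 * (\<gamma> (Suc n) * z ^ Suc n)) sums L z"
    using is_log_coeffs_log_coeff[OF f] unfolding is_log_coeffs_def \<gamma>_def by blast
  have "(\<lambda>n. (2 * \<gamma> n) * z ^ n) sums L z" if "norm z < 1" for z
  proof -
    have "(\<lambda>n. (2 * \<gamma> (Suc n)) * z ^ Suc n) sums L z"
      using sums[of z] that by (simp add: mult.assoc)
    then show ?thesis
      by (subst (asm) sums_Suc_iff) (simp add: \<gamma>0)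
  qed
  note Lderivs = derivs_of_power_series_at_0[OF L(1) this]
  have hf: "f holomorphic_on ?D"
    using f by (simp add: class_S_def)
  have h\<omega>: "\<omega> holomorphic_on ?D" and \<omega>0: "\<omega> 0 = 0"
    using \<omega> by (auto simp: schwarz_function_def)
  have D: "(h has_field_derivative deriv h z) (at z)"
    "(deriv h has_field_derivative deriv (deriv h) z) (at z)"
    if "h holomorphic_on ?D" "z \<in> ?D" for h z
    using holomorphic_derivI[OF that(1) open_ball that(2)]
      holomorphic_derivI[OF holomorphic_deriv[OF that(1) open_ball] open_ball that(2)]
    by auto
  note DL = D[OF L(1)] and D\<omega> = D[OF h\<omega>]
  have f_eq: "f z = z * exp (L z)" if "z \<in> ?D" for z
    using expL[of z] that class_S_zero[OF f] by (cases "z = 0") auto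
  have A: "exp (L z) * (1 + z * deriv L z) = \<phi> (\<omega> z)" if "z \<in> ?D" for z
  proof -
    have "deriv f z = exp (L z) * (1 + z * deriv L z)"
    proof (rule deriv_eq_if_eq_on_open[OF open_ball that f_eq D(1)[OF hf that]])
      show "((\<lambda>z. z * exp (L z)) has_field_derivative exp (L z) * (1 + z * deriv L z)) (at z)"
        using DL(1)[OF that] by (auto intro!: derivative_eq_intros simp: algebra_simps)
    qed
    then show ?thesis
      using sub[of z] that by simp
  qed
  have B: "exp (L z) * (2 * deriv L z + z * (deriv L z)\<^sup>2 + z * deriv (deriv L) z)
      = exp (\<omega> z) * (1 + sin (\<omega> z) + cos (\<omega> z)) * deriv \<omega> z" if "z \<in> ?D" for z
  proof (rule deriv_eq_if_eq_on_open[OF open_ball that A])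
    show "((\<lambda>z. exp (L z) * (1 + z * deriv L z)) has_field_derivative
        exp (L z) * (2 * deriv L z + z * (deriv L z)\<^sup>2 + z * deriv (deriv L) z)) (at z)"
      using DL[OF that]
      by (auto intro!: derivative_eq_intros simp: algebra_simps power2_eq_square)
    show "((\<lambda>z. \<phi> (\<omega> z)) has_field_derivative
        exp (\<omega> z) * (1 + sin (\<omega> z) + cos (\<omega> z)) * deriv \<omega> z) (at z)"
      using DERIV_chain2[OF DERIV_phi D\<omega>(1)[OF that]] .
  qed
  have L1: "deriv L 0 = deriv \<omega> 0"
    using B[of 0] L(2) \<omega>0 by simp
  have D3: "(deriv (deriv L) has_field_derivative deriv (deriv (deriv L)) 0) (at 0)"
    by (rule D(2)[OF holomorphic_deriv[OF L(1) open_ball]]) simp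
  have C: "3 * (deriv L 0)\<^sup>2 + 3 * deriv (deriv L) 0
      = 3 * (deriv \<omega> 0)\<^sup>2 + 2 * deriv (deriv \<omega>) 0"
  proof (rule deriv_eq_if_eq_on_open[OF open_ball[of 0 1] _ B])
    show "((\<lambda>z. exp (L z) * (2 * deriv L z + z * (deriv L z)\<^sup>2 + z * deriv (deriv L) z))
        has_field_derivative 3 * (deriv L 0)\<^sup>2 + 3 * deriv (deriv L) 0) (at 0)"
      using DL[of 0] D3 L(2)
      by (auto intro!: derivative_eq_intros simp: algebra_simps power2_eq_square)
    show "((\<lambda>z. exp (\<omega> z) * (1 + sin (\<omega> z) + cos (\<omega> z)) * deriv \<omega> z)
        has_field_derivative 3 * (deriv \<omega> 0)\<^sup>2 + 2 * deriv (deriv \<omega>) 0) (at 0)"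
      using D\<omega>[of 0] \<omega>0
      by (auto intro!: derivative_eq_intros simp: algebra_simps power2_eq_square)
  qed auto
  then have "3 * deriv (deriv L) 0 = 2 * deriv (deriv \<omega>) 0"
    using L1 by simp
  then have "deriv (deriv L) 0 = 2 * deriv (deriv \<omega>) 0 / 3"
    by (simp add: field_simps)
  then show "log_coeff f 1 = deriv \<omega> 0 / 2" "log_coeff f 2 = deriv (deriv \<omega>) 0 / 6"
    using Lderivs L1 by (auto simp: \<gamma>_def field_simps)
qed

section \<open>A univalence criterion\<close>

text \<open>
  Noshiro-Warschawski: along the segment from \<open>z\<close> to \<open>w\<close> the real function
  \<open>t \<mapsto> Re (c f / (w - z))\<close> is strictly increasing, so the end points have different images.
\<close>

lemma inj_on_convex_if_Re_deriv_pos: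
  fixes f f' :: "complex \<Rightarrow> complex"
  assumes "convex S"
    and D: "\<And>z. z \<in> S \<Longrightarrow> (f has_field_derivative f' z) (at z)"
    and pos: "\<And>z. z \<in> S \<Longrightarrow> Re (c * f' z) > 0"
  shows "inj_on f S"
proof (rule inj_onI, rule ccontr)
  fix z w assume zw: "z \<in> S" "w \<in> S" "f z = f w" "z \<noteq> w"
  define u where "u = (\<lambda>t. Re (c * f (z + of_real t * (w - z)) / (w - z)))"
  have "u 0 < u 1"
  proof (rule DERIV_pos_imp_increasing[of 0 1 u])
    fix t :: real assume t: "0 \<le> t" "t \<le> 1"
    let ?p = "z + of_real t * (w - z)"
    have p: "?p \<in> S"
      using convexD_alt[OF \<open>convex S\<close> zw(1,2) t] by (simp add: scaleR_conv_of_real algebra_simps)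
    have "((\<lambda>x. c * f (z + x * (w - z)) / (w - z)) has_field_derivative c * f' ?p) (at (of_real t))"
    proof -
      have "((\<lambda>x. f (z + x * (w - z))) has_field_derivative f' ?p * (w - z)) (at (of_real t))"
        by (rule DERIV_chain2[where f = f and g = "\<lambda>x. z + x * (w - z)", OF D[OF p]])
          (auto intro!: derivative_eq_intros)
      from DERIV_cdivide[OF DERIV_cmult[OF this, of c], of "w - z"] show ?thesis
        using zw(4) by (simp add: mult.assoc)
    qed
    then have "((\<lambda>x. c * f (z + of_real x * (w - z)) / (w - z)) has_vector_derivative c * f' ?p) (at t)"
      using has_vector_derivative_real_field by blast
    then have "(u has_field_derivative Re (c * f' ?p)) (at t)"
      unfolding u_def by (simp add: has_vector_derivative_complex_iff)
    then show "\<exists>y. (u has_real_derivative y) (at t) \<and> 0 < y"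
      using pos[OF p] by blast
  qed simp
  then show False
    using zw by (simp add: u_def)
qed


section \<open>The argument of the subordinating function on a half disc\<close>

text \<open>
  In the form \<open>tanh y \<le> y\<close> this makes \<open>(1 - y\<^sup>2) cosh\<^sup>2 y\<close> at most \<open>cosh\<^sup>2 y - sinh\<^sup>2 y = 1\<close>.
\<close>

lemma sinh_le_self_mult_cosh:
  fixes y :: real
  assumes "0 \<le> y"
  shows "sinh y \<le> y * cosh y"
proof -
  have "0 * cosh 0 - sinh 0 \<le> y * cosh y - sinh y"
  proof (rule DERIV_nonneg_imp_nondecreasing[OF assms])
    fix x :: real assume "0 \<le> x"
    have "((\<lambda>x. x * cosh x - sinh x) has_real_derivative x * sinh x) (at x)"
      by (auto intro!: derivative_eq_intros)
    then show "\<exists>d. ((\<lambda>x. x * cosh x - sinh x) has_real_derivative d) (at x) \<and> 0 \<le> d"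
      using \<open>0 \<le> x\<close> by fastforce
  qed
  then show ?thesis
    by simp
qed

text \<open>
  For \<open>z = x + i y\<close> in the disc,
  \<open>(Re (sin z))\<^sup>2 = sin\<^sup>2 x cosh\<^sup>2 y \<le> x\<^sup>2 cosh\<^sup>2 y < (1 - y\<^sup>2) cosh\<^sup>2 y \<le> 1\<close>.
\<close>

lemma abs_Re_sin_less_1:
  assumes "norm z < 1"
  shows "\<bar>Re (sin z)\<bar> < 1"
proof -
  define x y where "x = Re z" and "y = Im z"
  have xy: "x\<^sup>2 + y\<^sup>2 < 1"
    using assms by (simp add: x_def y_def cmod_def)
  have "\<bar>sin x\<bar> \<le> \<bar>x\<bar>"
    by (rule abs_sin_x_le_abs_x)
  then have "(sin x)\<^sup>2 \<le> x\<^sup>2"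
    by (simp add: abs_le_square_iff)
  then have "(sin x * cosh y)\<^sup>2 \<le> x\<^sup>2 * (cosh y)\<^sup>2"
    by (simp add: power_mult_distrib mult_right_mono)
  also have "\<dots> < (1 - y\<^sup>2) * (cosh y)\<^sup>2"
    using xy by (intro mult_strict_right_mono) auto
  also have "\<dots> \<le> (cosh y)\<^sup>2 - (sinh y)\<^sup>2"
  proof -
    have "sinh \<bar>y\<bar> \<le> \<bar>y\<bar> * cosh \<bar>y\<bar>"
      by (rule sinh_le_self_mult_cosh) simp
    then have "(sinh \<bar>y\<bar>)\<^sup>2 \<le> (\<bar>y\<bar> * cosh \<bar>y\<bar>)\<^sup>2"
      by (intro power_mono) auto
    then have "(sinh y)\<^sup>2 \<le> y\<^sup>2 * (cosh y)\<^sup>2"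
      by (cases "y \<ge> 0") (auto simp: power_mult_distrib)
    then show ?thesis
      by (simp add: algebra_simps)
  qed
  also have "\<dots> = 1"
    by (simp add: cosh_square_eq)
  finally have "(sin x * cosh y)\<^sup>2 < 1" .
  then have "\<bar>sin x * cosh y\<bar> < 1"
    by (simp add: abs_square_less_1)
  then show ?thesis
    by (simp add: Re_sin x_def y_def cosh_def)
qed

text \<open>
  Here \<open>\<phi> z = exp x (cos y + i sin y) (A + i B)\<close> with \<open>A = 1 + Re (sin z) > 0\<close> and
  \<open>B = Im (sin z) \<ge> 0\<close>. Any factor \<open>1 - k i\<close> with \<open>k \<ge> tan 1\<close> would make the coefficient of
  \<open>B\<close> nonnegative, and \<open>k = 2\<close> is such a number.
\<close>

lemma Re_rotated_phi_pos:
  assumes "norm z < 1" "0 \<le> Im z"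
  shows "0 < Re ((1 - 2 * \<i>) * \<phi> z)"
proof -
  define x y where "x = Re z" and "y = Im z"
  have x: "\<bar>x\<bar> < 1" and y: "0 \<le> y" "y < 1"
    using assms abs_Re_le_cmod[of z] abs_Im_le_cmod[of z] by (auto simp: x_def y_def)
  have A: "0 < 1 + Re (sin z)"
    using abs_Re_sin_less_1[OF assms(1)] by linarith
  have "cos \<bar>x\<bar> > 0"
    using x pi_gt3 by (intro cos_gt_zero_pi) auto
  then have B: "0 \<le> Im (sin z)"
    using y by (simp add: Im_sin x_def y_def)
  have sy: "0 \<le> sin y"
    using y pi_gt3 by (intro sin_ge_zero) auto
  have cy: "0 < cos y"
    using y pi_gt3 by (intro cos_gt_zero_pi) auto
  have cs: "sin y \<le> 2 * cos y"
  proof -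
    have "cos (pi / 3) \<le> cos y"
      using y pi_gt3 by (intro cos_monotone_0_pi_le) auto
    then have "1 / 2 \<le> cos y"
      by (simp add: cos_60)
    then show ?thesis
      using sin_le_one[of y] by linarith
  qed
  have "Re ((1 - 2 * \<i>) * \<phi> z)
      = exp x * ((cos y + 2 * sin y) * (1 + Re (sin z)) + (2 * cos y - sin y) * Im (sin z))"
    by (simp add: \<phi>_def Re_exp Im_exp x_def y_def algebra_simps)
  also have "\<dots> > 0"
  proof -
    have "0 < (cos y + 2 * sin y) * (1 + Re (sin z))"
      using A sy cy by (intro mult_pos_pos) auto
    moreover have "0 \<le> (2 * cos y - sin y) * Im (sin z)"
      using B cs by (intro mult_nonneg_nonneg) auto
    ultimately show ?thesis
      by (intro mult_pos_pos) auto
  qed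
  finally show ?thesis .
qed

lemma cnj_phi: "cnj (\<phi> z) = \<phi> (cnj z)"
  by (simp add: \<phi>_def exp_cnj cnj_sin)

lemma Re_rotated_phi_pos':
  assumes "norm z < 1" "Im z \<le> 0"
  shows "0 < Re ((1 + 2 * \<i>) * \<phi> z)"
  using Re_rotated_phi_pos[of "cnj z"] assms by (simp flip: cnj_phi)

section \<open>A polynomial approximation of the subordinating function\<close>

lemma fact_mult_power_le: "fact n * (n + 1) ^ k \<le> (fact (k + n) :: nat)"
proof (induction k)
  case (Suc k)
  have "fact n * (n + 1) ^ Suc k = (n + 1) * (fact n * (n + 1) ^ k)"
    by (simp only: power_Suc mult_ac)
  also have "\<dots> \<le> (k + n + 1) * fact (k + n)"
    using Suc.IH by (intro mult_mono) auto
  finally show ?case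
    by simp
qed simp

text \<open>
  The remainder series is dominated by a geometric series of ratio \<open>norm z / (n + 1)\<close>; the
  remainder with factor \<open>exp (norm z) / fact (n - 1)\<close> coming from Taylor's theorem would exceed the
  margin left by the polynomial estimates below.
\<close>

lemma norm_exp_remainder_le:
  fixes z :: complex
  assumes "norm z < real (n + 1)"
  shows "norm (exp z - (\<Sum>k<n. z ^ k / fact k))
    \<le> norm z ^ n / fact n * (real (n + 1) / (real (n + 1) - norm z))"
proof -
  have "(\<lambda>k. z ^ k / fact k) sums exp z"
    using exp_converges[of z] by (simp add: scaleR_conv_of_real field_simps)
  then have S: "(\<lambda>k. z ^ (k + n) / fact (k + n)) sums (exp z - (\<Sum>k<n. z ^ k / fact k))"
    by (rule sums_split_initial_segment)
  define q where "q = norm z / real (n + 1)"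
  have q: "0 \<le> q" "q < 1"
    using assms by (auto simp: q_def field_simps)
  have G: "(\<lambda>k. norm z ^ n / fact n * q ^ k) sums (norm z ^ n / fact n * (1 / (1 - q)))"
    using q by (intro sums_mult geometric_sums) auto
  have q_eq: "1 / (1 - q) = real (n + 1) / (real (n + 1) - norm z)"
    using assms unfolding q_def by (simp add: divide_simps)
  have "norm (z ^ (k + n) / fact (k + n)) \<le> norm z ^ n / fact n * q ^ k" for k
  proof -
    have "real (fact n * (n + 1) ^ k) \<le> real (fact (k + n))"
      using fact_mult_power_le by (simp only: of_nat_le_iff)
    then have fact_le: "real (fact n * (n + 1) ^ k) \<le> fact (k + n)"
      by (simp only: of_nat_fact)
    have "norm (z ^ (k + n) / fact (k + n)) = norm z ^ k * norm z ^ n / fact (k + n)"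
      by (simp add: norm_divide norm_power norm_mult power_add)
    also have "\<dots> \<le> norm z ^ k * norm z ^ n / real (fact n * (n + 1) ^ k)"
      using fact_le by (intro divide_left_mono) auto
    also have "\<dots> = norm z ^ n / fact n * q ^ k"
      by (simp add: q_def power_divide)
    finally show ?thesis .
  qed
  from norm_sums_le[OF S G this] show ?thesis
    by (simp only: q_eq)
qed

definition \<phi>5 :: "complex \<Rightarrow> complex" where
  "\<phi>5 z = 1 + 2 * z + 3 / 2 * z ^ 2 + 1 / 2 * z ^ 3 + 1 / 24 * z ^ 4 - 1 / 40 * z ^ 5"

text \<open>
  By \<open>exp z * sin z = (exp (a z) - exp (b z)) / (2 i)\<close> with \<open>a = 1 + i\<close> and \<open>b = 1 - i\<close> the
  remainder of \<open>\<phi>\<close> is a combination of three exponential remainders, with arguments of modulus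
  at most 1 and \<open>sqrt 2\<close>.
\<close>

lemma norm_phi_minus_phi5_le:
  assumes "norm z \<le> 1"
  shows "norm (\<phi> z - \<phi>5 z) \<le> 2 / 125"
proof -
  define R where "R = (\<lambda>z::complex. exp z - (\<Sum>k<6. z ^ k / fact k))"
  define a b where "a = 1 + \<i>" and "b = 1 - \<i>"
  have pa: "a ^ 2 = 2 * \<i>" "a ^ 3 = -2 + 2 * \<i>" "a ^ 4 = -4" "a ^ 5 = -4 - 4 * \<i>"
    and pb: "b ^ 2 = -2 * \<i>" "b ^ 3 = -2 - 2 * \<i>" "b ^ 4 = -4" "b ^ 5 = -4 + 4 * \<i>"
    by (simp_all add: a_def b_def complex_eq_iff eval_nat_numeral)
  have "exp z * sin z = (exp (a * z) - exp (b * z)) / (2 * \<i>)"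
    by (simp add: sin_exp_eq a_def b_def ring_distribs exp_add exp_diff exp_minus field_simps)
  then have phi: "\<phi> z = exp z + (exp (a * z) - exp (b * z)) / (2 * \<i>)"
    by (simp add: \<phi>_def ring_distribs)
  have "\<phi>5 z = (\<Sum>k<6. z ^ k / fact k)
      + ((\<Sum>k<6. (a * z) ^ k / fact k) - (\<Sum>k<6. (b * z) ^ k / fact k)) / (2 * \<i>)"
    by (simp add: lessThan_nat_numeral fact_numeral power_mult_distrib pa pb \<phi>5_def)
      (simp add: a_def b_def field_simps)
  then have "\<phi> z - \<phi>5 z = R z + (R (a * z) - R (b * z)) / (2 * \<i>)"
    by (simp add: phi R_def field_simps)
  then have "norm (\<phi> z - \<phi>5 z) \<le> norm (R z) + norm ((R (a * z) - R (b * z)) / (2 * \<i>))"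
    by (simp only: norm_triangle_ineq)
  also have "norm ((R (a * z) - R (b * z)) / (2 * \<i>)) = norm (R (a * z) - R (b * z)) / 2"
    by (simp add: norm_divide norm_mult)
  also have "\<dots> \<le> (norm (R (a * z)) + norm (R (b * z))) / 2"
    by (intro divide_right_mono norm_triangle_ineq4) simp
  finally have tri: "norm (\<phi> z - \<phi>5 z) \<le> norm (R z) + (norm (R (a * z)) + norm (R (b * z))) / 2"
    by simp
  have R_le: "norm (R w) \<le> r ^ 6 / 720 * (7 / (7 - r))" if "norm w \<le> r" "r < 7" for w r
  proof -
    have "norm (R w) \<le> norm w ^ 6 / 720 * (7 / (7 - norm w))"
      using norm_exp_remainder_le[of w 6] that by (simp add: R_def fact_numeral)
    also have "\<dots> \<le> r ^ 6 / 720 * (7 / (7 - r))"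
      using that by (intro mult_mono divide_mono power_mono) auto
    finally show ?thesis .
  qed
  have R_sqrt2: "norm (R (c * z)) \<le> 8 / 720 * (7 / (7 - 3 / 2))" if "norm c = sqrt 2" for c
  proof -
    have "norm (c * z) \<le> sqrt 2"
      using assms that by (simp add: norm_mult mult_left_le)
    moreover have s: "sqrt 2 \<le> 3 / 2"
      by (rule real_le_lsqrt) (auto simp: power2_eq_square)
    ultimately have "norm (R (c * z)) \<le> sqrt 2 ^ 6 / 720 * (7 / (7 - sqrt 2))"
      by (intro R_le) auto
    also have "sqrt 2 ^ 6 = 8"
      using power_mult[of "sqrt 2" 2 3] by simp
    also have "8 / 720 * (7 / (7 - sqrt 2)) \<le> 8 / 720 * (7 / (7 - 3 / 2))"
      using s by (intro mult_left_mono divide_left_mono mult_pos_pos) auto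
    finally show ?thesis .
  qed
  have "norm a = sqrt 2" "norm b = sqrt 2"
    by (auto simp: a_def b_def cmod_def)
  then have "norm (R (a * z)) \<le> 8 / 720 * (7 / (7 - 3 / 2))"
    "norm (R (b * z)) \<le> 8 / 720 * (7 / (7 - 3 / 2))"
    by (intro R_sqrt2; simp)+
  with tri have "norm (\<phi> z - \<phi>5 z) \<le> norm (R z) + 8 / 720 * (7 / (7 - 3 / 2))"
    by argo
  moreover have "norm (R z) \<le> 1 / 720 * (7 / 6)"
    using R_le[of z 1] assms by simp
  ultimately show ?thesis
    by simp
qed

section \<open>Signs of imaginary parts of real primitives\<close>

text \<open>
  \<open>T\<close> is real on the real diameter, so \<open>Im (T z)\<close> is bounded by the variation of \<open>T\<close> along the
  vertical segment from \<open>Re z\<close> to \<open>z\<close>. The factor \<open>Im z\<close> matters: an error term of constant size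
  would say nothing near the real axis.
\<close>

lemma abs_Im_primitive_le:
  assumes D: "\<And>z. norm z < 1 \<Longrightarrow> (T has_field_derivative t z) (at z)"
    and "T 0 = 0"
    and real: "\<And>x::real. norm x < 1 \<Longrightarrow> Im (t (of_real x)) = 0"
    and le: "\<And>z. norm z < 1 \<Longrightarrow> norm (t z) \<le> \<delta>"
    and z: "norm z < 1"
  shows "\<bar>Im (T z)\<bar> \<le> \<delta> * \<bar>Im z\<bar>"
proof -
  have "((\<lambda>x. Im (T (of_real x))) has_real_derivative 0) (at x within {-1<..<1})"
    if "x \<in> {-1<..<1}" for x :: real
  proof -
    have "((\<lambda>x. T (of_real x)) has_vector_derivative t (of_real x)) (at x within {-1<..<1})"
      using that by (intro has_vector_derivative_real_field D) auto
    then have "((\<lambda>x. Im (T (of_real x))) has_real_derivative Im (t (of_real x))) (at x within {-1<..<1})"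
      by (simp add: has_vector_derivative_complex_iff)
    then show ?thesis
      using real[of x] that by auto
  qed
  then have "\<exists>c. \<forall>x\<in>{-1<..<1}. Im (T (of_real x)) = c"
    by (intro has_field_derivative_zero_constant convex_real_interval)
  then obtain c where c: "\<And>x. x \<in> {-1<..<1} \<Longrightarrow> Im (T (of_real x)) = c"
    by blast
  have "Re z \<in> {-1<..<1}"
    using z abs_Re_le_cmod[of z] by auto
  then have "Im (T (of_real (Re z))) = Im (T (of_real 0))"
    using c[of "Re z"] c[of 0] by simp
  then have "Im (T (of_real (Re z))) = 0"
    using \<open>T 0 = 0\<close> by simp
  then have "\<bar>Im (T z)\<bar> = \<bar>Im (T z - T (of_real (Re z)))\<bar>"
    by simp
  also have "\<dots> \<le> norm (T z - T (of_real (Re z)))"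
    by (rule abs_Im_le_cmod)
  also have "\<dots> \<le> \<delta> * norm (z - of_real (Re z))"
  proof (rule field_differentiable_bound[of "ball 0 1" T t])
    show "(T has_field_derivative t w) (at w within ball 0 1)" if "w \<in> ball 0 1" for w
      using that D[of w] by (auto intro: has_field_derivative_at_within)
  qed (use z le abs_Re_le_cmod[of z] in auto)
  also have "norm (z - of_real (Re z)) = \<bar>Im z\<bar>"
    by (simp add: cmod_def)
  finally show ?thesis .
qed

text \<open>
  The maximum principle for the harmonic function \<open>Im (P z - c z)\<close>, which vanishes on the real
  diameter.
\<close>

lemma Im_ge_on_half_disc_if_on_arc:
  assumes hol: "P holomorphic_on UNIV"
    and real: "\<And>x::real. Im (P (of_real x)) = 0"
    and arc: "\<And>z. \<lbrakk>norm z = 1; 0 \<le> Im z\<rbrakk> \<Longrightarrow> c * Im z \<le> Im (P z)"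
    and z: "norm z < 1" "0 \<le> Im z"
  shows "c * Im z \<le> Im (P z)"
proof -
  have real': "Im (P z) = 0" if "Im z = 0" for z
  proof -
    have "of_real (Re z) = z"
      using that by (simp add: complex_eq_iff)
    then show ?thesis
      using real[of "Re z"] by simp
  qed
  define S where "S = ball 0 1 \<inter> {z. 0 < Im z}"
  have "open S"
    unfolding S_def by (intro open_Int open_ball open_halfspace_Im_gt)
  have "closure S \<subseteq> cball 0 1 \<inter> {z. 0 \<le> Im z}"
    unfolding S_def
    by (intro closure_minimal closed_Int closed_cball closed_halfspace_Im_ge) auto
  then have fr: "norm w \<le> 1" "0 \<le> Im w" "w \<notin> S" if "w \<in> frontier S" for w
    using that \<open>open S\<close> by (auto simp: frontier_def interior_open)
  have hf: "(\<lambda>w. \<i> * (P w - of_real c * w)) holomorphic_on A" for A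
    using hol by (intro holomorphic_intros) (auto intro: holomorphic_on_subset)
  show ?thesis
  proof (cases "Im z = 0")
    case True
    then show ?thesis
      using real' by simp
  next
    case False
    have "Re (\<i> * (P z - of_real c * z)) \<le> 0"
    proof (rule maximum_real_frontier[where S = S and f = "\<lambda>w. \<i> * (P w - of_real c * w)"])
      show "Re (\<i> * (P w - of_real c * w)) \<le> 0" if w: "w \<in> frontier S" for w
      proof (cases "Im w = 0")
        case True
        then show ?thesis
          using real' by simp
      next
        case False
        then have "norm w = 1"
          using fr[OF w] by (auto simp: S_def)
        then show ?thesis
          using arc[of w] fr[OF w] by simp
      qed
      show "bounded S"
        by (auto simp: S_def intro: bounded_Int)
      show "z \<in> S"
        using z False by (simp add: S_def)
    qed (auto intro: hf holomorphic_on_imp_continuous_on)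
    then show ?thesis
      by simp
  qed
qed

text \<open>
  The map \<open>\<sigma>\<close> stands for \<open>z\<close>, \<open>z\<^sup>2\<close> and \<open>- z\<^sup>2\<close>. The conclusion holds because the
  truncation error \<open>2/125\<close> is smaller than \<open>1/60\<close>.
\<close>

lemma sgn_Im_primitive:
  assumes D: "\<And>z. norm z < 1 \<Longrightarrow> (G has_field_derivative \<phi> (\<sigma> z)) (at z)"
    and DP: "\<And>z. (P has_field_derivative \<phi>5 (\<sigma> z)) (at z)"
    and zero: "G 0 = 0" "P 0 = 0"
    and \<sigma>: "\<And>z. norm z < 1 \<Longrightarrow> norm (\<sigma> z) \<le> 1" "\<And>x::real. \<sigma> (of_real x) \<in> \<real>"
    and cnj: "\<And>z. cnj (P z) = P (cnj z)"
    and arc: "\<And>z. \<lbrakk>norm z = 1; 0 \<le> Im z\<rbrakk> \<Longrightarrow> 1 / 60 * Im z \<le> Im (P z)"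
    and z: "norm z < 1"
  shows "sgn (Im (G z)) = sgn (Im z)"
proof -
  have "\<bar>Im (G z - P z)\<bar> \<le> 2 / 125 * \<bar>Im z\<bar>"
  proof (rule abs_Im_primitive_le[of "\<lambda>z. G z - P z" "\<lambda>z. \<phi> (\<sigma> z) - \<phi>5 (\<sigma> z)"])
    show "((\<lambda>z. G z - P z) has_field_derivative \<phi> (\<sigma> z) - \<phi>5 (\<sigma> z)) (at z)"
      if "norm z < 1" for z
      using D[OF that] DP by (rule DERIV_diff)
    show "Im (\<phi> (\<sigma> (of_real x)) - \<phi>5 (\<sigma> (of_real x))) = 0" for x :: real
    proof -
      obtain r where "\<sigma> (of_real x) = of_real r"
        using \<sigma>(2)[of x] by (auto elim: Reals_cases)
      moreover have "\<phi> (of_real r) \<in> \<real>" "\<phi>5 (of_real r) \<in> \<real>"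
        by (auto simp: \<phi>_def \<phi>5_def sin_of_real exp_of_real)
      ultimately show ?thesis
        by (simp add: complex_is_Real_iff)
    qed
  qed (use zero \<sigma>(1) z norm_phi_minus_phi5_le in auto)
  then have near: "\<bar>Im (G z) - Im (P z)\<bar> \<le> 2 / 125 * \<bar>Im z\<bar>"
    by simp
  have far: "1 / 60 * \<bar>Im z\<bar> \<le> sgn (Im z) * Im (P z) \<and> (Im z = 0 \<longrightarrow> Im (P z) = 0)"
  proof -
    have "P holomorphic_on UNIV"
      using DP by (auto simp: holomorphic_on_def field_differentiable_def)
    moreover have real: "Im (P (of_real x)) = 0" for x :: real
      using cnj[of "of_real x"] by (simp add: complex_eq_iff)
    ultimately have *: "1 / 60 * Im w \<le> Im (P w)" if "norm w < 1" "0 \<le> Im w" for w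
      using Im_ge_on_half_disc_if_on_arc[of P "1 / 60"] arc that by blast
    show ?thesis
    proof (cases "0 \<le> Im z")
      case True
      then show ?thesis
        using *[of z] z real[of "Re z"] by (auto simp: sgn_if of_real_Re complex_is_Real_iff)
    next
      case False
      then show ?thesis
        using *[of "cnj z"] z by (simp add: sgn_if flip: cnj)
    qed
  qed
  show ?thesis
  proof (cases "Im z" "0 :: real" rule: linorder_cases)
    case less
    then have "Im (G z) < 0"
      using near far by (simp add: abs_if split: if_splits)
    then show ?thesis
      using less by simp
  next
    case equal
    then show ?thesis
      using near far by simp
  next
    case greater
    then have "0 < Im (G z)"
      using near far by (simp add: abs_if split: if_splits)
    then show ?thesis
      using greater by simp
  qed
qed

section \<open>Trigonometric polynomials on the unit circle\<close>

lemma unit_circle_square: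
  assumes "norm v = 1"
  shows "v ^ 2 = of_real (2 * Re v) * v - 1"
proof -
  have "(Re v)\<^sup>2 + (Im v)\<^sup>2 = 1"
    using assms by (simp add: cmod_def)
  then show ?thesis
    by (simp add: complex_eq_iff power2_eq_square algebra_simps)
qed

text \<open>
  The Chebyshev recurrence for \<open>sin (k \<theta>)\<close> in steps of \<open>m \<theta>\<close>.
\<close>

lemma Im_power_recurrence:
  assumes "norm z = 1"
  shows "Im (z ^ (k + 2 * m)) = 2 * Re (z ^ m) * Im (z ^ (k + m)) - Im (z ^ k)"
proof -
  have "norm (z ^ m) = 1"
    using assms by (simp add: norm_power)
  have "z ^ (k + 2 * m) = z ^ k * (z ^ m)\<^sup>2"
    by (simp add: power_add power_even_eq)
  also have "\<dots> = z ^ k * (of_real (2 * Re (z ^ m)) * z ^ m - 1)"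
    by (simp only: unit_circle_square[OF \<open>norm (z ^ m) = 1\<close>])
  finally have "Im (z ^ (k + 2 * m)) = Im (z ^ k * (of_real (2 * Re (z ^ m)) * z ^ m - 1))"
    by (rule arg_cong)
  moreover have "Im (z ^ k * (of_real r * z ^ m - 1)) = r * Im (z ^ (k + m)) - Im (z ^ k)" for r
    by (simp add: power_add algebra_simps)
  ultimately show ?thesis
    by (simp only:)
qed

text \<open>
  With \<open>u = b - x\<close> and \<open>v = x - a\<close> this certifies that a quintic written in the Bernstein basis
  of \<open>{a..b}\<close> is nonnegative on that interval.
\<close>

lemma bernstein_quintic_nonneg:
  fixes u v :: real
  assumes "0 \<le> u" "0 \<le> v" "0 \<le> b0" "0 \<le> b1" "0 \<le> b2" "0 \<le> b3" "0 \<le> b4" "0 \<le> b5"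
  shows "0 \<le> b0 * u ^ 5 + b1 * u ^ 4 * v + b2 * u ^ 3 * v ^ 2 + b3 * u ^ 2 * v ^ 3
    + b4 * u * v ^ 4 + b5 * v ^ 5"
  using assms by simp

text \<open>
  The polynomial is the primitive of \<open>\<phi>5\<close>. On the unit circle \<open>Im (z ^ k) / Im z\<close> is a Chebyshev
  polynomial of the second kind in \<open>x = Re z\<close>, so the claim is about a quintic in
  \<open>x \<in> {-1..1}\<close>. The constant \<open>1/60\<close> is the largest one for which all its Bernstein coefficients
  on the undivided interval are nonnegative; the second one vanishes.
\<close>

lemma arc_bound_id:
  assumes z: "norm z = 1" "0 \<le> Im z"
  shows "1 / 60 * Im z
    \<le> Im (z + z ^ 2 + 1 / 2 * z ^ 3 + 1 / 8 * z ^ 4 + 1 / 120 * z ^ 5 - 1 / 240 * z ^ 6)"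
proof -
  define x where "x = Re z"
  have x: "0 \<le> 1 - x" "0 \<le> 1 + x"
    using abs_Re_le_cmod[of z] z by (auto simp: x_def)
  define y where "y = Im z"
  define s where "s = (\<lambda>k. Im (z ^ k))"
  have rec: "s (k + 2) = 2 * x * s (k + 1) - s k" for k
    using Im_power_recurrence[OF z(1), of k 1] by (simp add: x_def s_def)
  have s01: "s 0 = 0" "s (Suc 0) = y"
    by (simp_all add: s_def y_def)
  have s2: "s 2 = y * (2 * x)"
    using rec[of 0] by (simp add: s01 numeral_2_eq_2)
  have s3: "s 3 = y * (4 * x ^ 2 - 1)"
    using rec[of 1] s01 s2 by (simp add: eval_nat_numeral algebra_simps)
  have s4: "s 4 = y * (8 * x ^ 3 - 4 * x)"
    using rec[of 2] by (simp add: s2 s3) (simp add: eval_nat_numeral algebra_simps)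
  have s5: "s 5 = y * (16 * x ^ 4 - 12 * x ^ 2 + 1)"
    using rec[of 3] by (simp add: s3 s4) (simp add: eval_nat_numeral algebra_simps)
  have s6: "s 6 = y * (32 * x ^ 5 - 32 * x ^ 3 + 6 * x)"
    using rec[of 4] by (simp add: s4 s5) (simp add: eval_nat_numeral algebra_simps)
  have "Im (z + z ^ 2 + 1 / 2 * z ^ 3 + 1 / 8 * z ^ 4 + 1 / 120 * z ^ 5 - 1 / 240 * z ^ 6)
      - 1 / 60 * Im z
    = y + s 2 + s 3 / 2 + s 4 / 8 + s 5 / 120 - s 6 / 240 - y / 60"
    by (simp add: y_def s_def)
  also have "\<dots> = y * ((1 / 20 * (1 - x) ^ 5 + 0 * (1 - x) ^ 4 * (1 + x)
      + 61 / 30 * (1 - x) ^ 3 * (1 + x) ^ 2 + 11 / 15 * (1 - x) ^ 2 * (1 + x) ^ 3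
      + 95 / 12 * (1 - x) * (1 + x) ^ 4 + 5 * (1 + x) ^ 5) / 32)"
    unfolding s2 s3 s4 s5 s6 by (simp add: eval_nat_numeral field_simps)
  also have "\<dots> \<ge> 0"
    using z(2) x
    by (intro mult_nonneg_nonneg divide_nonneg_nonneg bernstein_quintic_nonneg) (auto simp: y_def)
  finally show ?thesis
    by simp
qed

text \<open>
  The polynomial is the primitive of \<open>\<phi>5 (\<epsilon> z\<^sup>2)\<close>. It is odd, so \<open>Im (z ^ k)\<close> occurs only for
  odd \<open>k\<close>, and \<open>Im (z ^ k) / Im z\<close> is a polynomial in \<open>a = Re (z\<^sup>2)\<close>. For \<open>\<epsilon> = -1\<close> the
  quintic comes so close to \<open>1/60\<close> that the interval has to be divided at \<open>1/4\<close> to obtain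
  nonnegative Bernstein coefficients.
\<close>

lemma arc_bound_square:
  assumes z: "norm z = 1" "0 \<le> Im z" and \<epsilon>: "\<epsilon> = 1 \<or> \<epsilon> = -1"
  shows "1 / 60 * Im z \<le> Im (z + of_real \<epsilon> * (2 / 3 * z ^ 3) + 3 / 10 * z ^ 5
    + of_real \<epsilon> * (1 / 14 * z ^ 7) + 1 / 216 * z ^ 9 - of_real \<epsilon> * (1 / 440 * z ^ 11))"
proof -
  define a where "a = Re (z ^ 2)"
  have "norm (z ^ 2) = 1"
    using z by (simp add: norm_power)
  then have a: "0 \<le> 1 - a" "0 \<le> 1 + a"
    using abs_Re_le_cmod[of "z ^ 2"] by (auto simp: a_def)
  define y where "y = Im z"
  have y: "0 \<le> y"
    using z(2) by (simp add: y_def)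
  define s where "s = (\<lambda>k. Im (z ^ k))"
  have rec: "s (k + 4) = 2 * a * s (k + 2) - s k" for k
    using Im_power_recurrence[OF z(1), of k 2] by (simp only: a_def s_def) simp
  have s1: "s (Suc 0) = y"
    by (simp add: s_def y_def)
  have s3: "s 3 = y * (2 * a + 1)"
  proof -
    have "(Re z)\<^sup>2 + (Im z)\<^sup>2 = 1"
      using z(1) by (simp add: cmod_def)
    then have *: "a = 2 * (Re z)\<^sup>2 - 1"
      by (simp add: a_def power2_eq_square)
    have "s 2 = 2 * Re z * y" "s 3 = 2 * Re z * s 2 - s 1"
      using Im_power_recurrence[OF z(1), of 0 1] Im_power_recurrence[OF z(1), of 1 1]
      by (simp_all add: s_def y_def numeral_2_eq_2 numeral_3_eq_3)
    then show ?thesis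
      by (simp add: * s1 power2_eq_square algebra_simps)
  qed
  have s5: "s 5 = y * (4 * a ^ 2 + 2 * a - 1)"
    using rec[of 1] s1 s3 by (simp add: eval_nat_numeral algebra_simps)
  have s7: "s 7 = y * (8 * a ^ 3 + 4 * a ^ 2 - 4 * a - 1)"
    using rec[of 3] by (simp add: s3 s5) (simp add: eval_nat_numeral algebra_simps)
  have s9: "s 9 = y * (16 * a ^ 4 + 8 * a ^ 3 - 12 * a ^ 2 - 4 * a + 1)"
    using rec[of 5] by (simp add: s5 s7) (simp add: eval_nat_numeral algebra_simps)
  have s11: "s 11 = y * (32 * a ^ 5 + 16 * a ^ 4 - 32 * a ^ 3 - 12 * a ^ 2 + 6 * a + 1)"
    using rec[of 7] by (simp add: s7 s9) (simp add: eval_nat_numeral algebra_simps)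
  define q where "q = 1 + \<epsilon> * (2 / 3) * (2 * a + 1) + 3 / 10 * (4 * a ^ 2 + 2 * a - 1)
    + \<epsilon> * (1 / 14) * (8 * a ^ 3 + 4 * a ^ 2 - 4 * a - 1)
    + 1 / 216 * (16 * a ^ 4 + 8 * a ^ 3 - 12 * a ^ 2 - 4 * a + 1)
    - \<epsilon> * (1 / 440) * (32 * a ^ 5 + 16 * a ^ 4 - 32 * a ^ 3 - 12 * a ^ 2 + 6 * a + 1) - 1 / 60"
  have "Im (z + of_real \<epsilon> * (2 / 3 * z ^ 3) + 3 / 10 * z ^ 5
      + of_real \<epsilon> * (1 / 14 * z ^ 7) + 1 / 216 * z ^ 9 - of_real \<epsilon> * (1 / 440 * z ^ 11))
      - 1 / 60 * Im z
    = y + \<epsilon> * (2 / 3) * s 3 + 3 / 10 * s 5 + \<epsilon> * (1 / 14) * s 7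
      + 1 / 216 * s 9 - \<epsilon> * (1 / 440) * s 11 - y / 60"
    by (simp add: y_def s_def)
  also have "\<dots> = y * q"
    unfolding s3 s5 s7 s9 s11 q_def by (simp add: algebra_simps)
  also have "\<dots> \<ge> 0"
  proof (rule mult_nonneg_nonneg[OF y])
    consider "\<epsilon> = 1" | "\<epsilon> = -1" "a \<le> 1 / 4" | "\<epsilon> = -1" "1 / 4 \<le> a"
      using \<epsilon> by linarith
    then show "0 \<le> q"
    proof cases
      case 1
      have "q = (11479 / 20790 * (1 - a) ^ 5 + 3043 / 945 * (1 - a) ^ 4 * (1 + a)
          + 309 / 35 * (1 - a) ^ 3 * (1 + a) ^ 2 + 100 / 9 * (1 - a) ^ 2 * (1 + a) ^ 3
          + 221 / 18 * (1 - a) * (1 + a) ^ 4 + 5 * (1 + a) ^ 5) / 32"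
        unfolding q_def 1 by (simp add: eval_nat_numeral field_simps)
      also have "\<dots> \<ge> 0"
        using a by (intro divide_nonneg_nonneg bernstein_quintic_nonneg) auto
      finally show ?thesis .
    next
      case 2
      \<comment> \<open>Bernstein form on \<open>{-1..1/4}\<close>; the factor is \<open>(4/5) ^ 5\<close>, the scaling by the length.\<close>
      define u where "u = 1 / 4 - a"
      define v where "v = 1 + a"
      have "q = (84149 / 41580 * u ^ 5 + 169657 / 33264 * u ^ 4 * v + 11663 / 2772 * u ^ 3 * v ^ 2
          + 72299 / 44352 * u ^ 2 * v ^ 3 + 1675 / 5544 * u * v ^ 4 + 7349 / 295680 * v ^ 5)
          * (1024 / 3125)"
        unfolding q_def 2 u_def v_def by (simp add: eval_nat_numeral field_simps)
      also have "\<dots> \<ge> 0"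
        using 2 a by (intro mult_nonneg_nonneg[OF bernstein_quintic_nonneg]) (auto simp: u_def v_def)
      finally show ?thesis .
    next
      case 3
      \<comment> \<open>Bernstein form on \<open>{1/4..1}\<close>, scaled by \<open>(4/3) ^ 5\<close>.\<close>
      define u where "u = 1 - a"
      define v where "v = a - 1 / 4"
      have "q = (7349 / 295680 * u ^ 5 + 59 / 3360 * u ^ 4 * v + 141 / 2240 * u ^ 3 * v ^ 2
          + 17 / 120 * u ^ 2 * v ^ 3 + 5 / 48 * u * v ^ 4 + 1 / 20 * v ^ 5) * (1024 / 243)"
        unfolding q_def 3 u_def v_def by (simp add: eval_nat_numeral field_simps)
      also have "\<dots> \<ge> 0"
        using 3 a by (intro mult_nonneg_nonneg[OF bernstein_quintic_nonneg]) (auto simp: u_def v_def)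
      finally show ?thesis .
    qed
  qed
  finally show ?thesis
    by simp
qed

section \<open>Univalence of the extremal functions\<close>

lemma inj_on_primitive_phi:
  assumes D: "\<And>z. norm z < 1 \<Longrightarrow> (F has_field_derivative \<phi> z) (at z)" and "F 0 = 0"
  shows "inj_on F (ball 0 1)"
proof (rule inj_onI)
  fix z w assume zw: "z \<in> ball 0 1" "w \<in> ball 0 1" "F z = F w"
  have sgn: "sgn (Im (F z)) = sgn (Im z)" if "norm z < 1" for z
    by (rule sgn_Im_primitive[where \<sigma> = "\<lambda>z. z" and P = "\<lambda>z. z + z ^ 2 + 1 / 2 * z ^ 3
          + 1 / 8 * z ^ 4 + 1 / 120 * z ^ 5 - 1 / 240 * z ^ 6", OF D])
      (use that \<open>F 0 = 0\<close> arc_bound_id in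
        \<open>auto intro!: derivative_eq_intros simp: \<phi>5_def field_simps\<close>)
  have "sgn (Im z) = sgn (Im w)"
    using zw sgn[of z] sgn[of w] by simp
  then consider "0 \<le> Im z" "0 \<le> Im w" | "Im z \<le> 0" "Im w \<le> 0"
    by (auto simp: sgn_if split: if_splits)
  then show "z = w"
  proof cases
    case 1
    have "inj_on F (ball 0 1 \<inter> {z. 0 \<le> Im z})"
      by (rule inj_on_convex_if_Re_deriv_pos[where c = "1 - 2 * \<i>" and f' = \<phi>])
        (use D Re_rotated_phi_pos in \<open>auto intro!: convex_Int convex_halfspace_Im_ge\<close>)
    then show ?thesis
      using zw 1 by (auto dest: inj_onD)
  next
    case 2
    have "inj_on F (ball 0 1 \<inter> {z. Im z \<le> 0})"
      by (rule inj_on_convex_if_Re_deriv_pos[where c = "1 + 2 * \<i>" and f' = \<phi>])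
        (use D Re_rotated_phi_pos' in \<open>auto intro!: convex_Int convex_halfspace_Im_le\<close>)
    then show ?thesis
      using zw 2 by (auto dest: inj_onD)
  qed
qed

lemma sgn_Im_primitive_square:
  assumes D: "\<And>z. norm z < 1 \<Longrightarrow> (G has_field_derivative \<phi> (of_real \<epsilon> * z\<^sup>2)) (at z)"
    and "G 0 = 0" and \<epsilon>: "\<epsilon> = 1 \<or> \<epsilon> = -1" and z: "norm z < 1"
  shows "sgn (Im (G z)) = sgn (Im z)"
proof (rule sgn_Im_primitive[where \<sigma> = "\<lambda>z. of_real \<epsilon> * z\<^sup>2" and P = "\<lambda>z. z
    + of_real \<epsilon> * (2 / 3 * z ^ 3) + 3 / 10 * z ^ 5 + of_real \<epsilon> * (1 / 14 * z ^ 7)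
    + 1 / 216 * z ^ 9 - of_real \<epsilon> * (1 / 440 * z ^ 11)", OF D])
  show "((\<lambda>z. z + of_real \<epsilon> * (2 / 3 * z ^ 3) + 3 / 10 * z ^ 5 + of_real \<epsilon> * (1 / 14 * z ^ 7)
      + 1 / 216 * z ^ 9 - of_real \<epsilon> * (1 / 440 * z ^ 11)) has_field_derivative
      \<phi>5 (of_real \<epsilon> * z\<^sup>2)) (at z)" for z
    using \<epsilon> by (auto intro!: derivative_eq_intros simp: \<phi>5_def power_mult_distrib simp flip: power_mult)
  show "norm (of_real \<epsilon> * z\<^sup>2) \<le> 1" if "norm z < 1" for z :: complex
    using that \<epsilon> by (auto simp: norm_mult norm_power power_le_one)
qed (use assms arc_bound_square in auto)

text \<open>
  The sign of \<open>Re G\<close> is reduced to a sign of an imaginary part by a rotation: \<open>i G (- i w)\<close> has the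
  derivative \<open>\<phi> (- w\<^sup>2)\<close>. Points with the same image thus lie in a common closed quadrant, which
  squaring sends into a closed half plane.
\<close>

lemma inj_on_primitive_phi_square:
  assumes D: "\<And>z. norm z < 1 \<Longrightarrow> (G has_field_derivative \<phi> (z\<^sup>2)) (at z)" and "G 0 = 0"
  shows "inj_on G (ball 0 1)"
proof (rule inj_onI)
  fix z w assume zw: "z \<in> ball 0 1" "w \<in> ball 0 1" "G z = G w"
  have sgn_Im: "sgn (Im (G z)) = sgn (Im z)" if "norm z < 1" for z
    using sgn_Im_primitive_square[of G 1] D that \<open>G 0 = 0\<close> by simp
  have sgn_Re: "sgn (Re (G z)) = sgn (Re z)" if "norm z < 1" for z
  proof -
    have "((\<lambda>w. \<i> * G (- \<i> * w)) has_field_derivative \<phi> (of_real (-1) * w\<^sup>2)) (at w)"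
      if "norm w < 1" for w
    proof -
      have "norm (- \<i> * w) < 1"
        using that by (simp add: norm_mult)
      then have "((\<lambda>w. G (- \<i> * w)) has_field_derivative \<phi> ((- \<i> * w)\<^sup>2) * (- \<i>)) (at w)"
        by (intro DERIV_chain2[where f = G and g = "\<lambda>w. - \<i> * w", OF D])
          (auto intro!: derivative_eq_intros)
      moreover have "\<i> * (\<phi> ((- \<i> * w)\<^sup>2) * (- \<i>)) = \<phi> (of_real (-1) * w\<^sup>2)"
        by (simp add: power_mult_distrib complex_eq_iff)
      ultimately show ?thesis
        using DERIV_cmult by metis
    qed
    then have "sgn (Im (\<i> * G (- \<i> * (\<i> * z)))) = sgn (Im (\<i> * z))"
      using that \<open>G 0 = 0\<close> by (intro sgn_Im_primitive_square[where \<epsilon> = "-1"]) (auto simp: norm_mult)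
    then show ?thesis
      by simp
  qed
  have Im_square: "Im (z\<^sup>2) = 2 * (Re z * Im z)" for z :: complex
    by (simp add: power2_eq_square)
  have inj: "inj_on G S"
    if "convex S" "S \<subseteq> ball 0 1"
      "(\<forall>z\<in>S. 0 \<le> Re z * Im z) \<or> (\<forall>z\<in>S. Re z * Im z \<le> 0)" for S
    using that(3)
  proof
    assume S: "\<forall>z\<in>S. 0 \<le> Re z * Im z"
    have "0 < Re ((1 - 2 * \<i>) * \<phi> (z\<^sup>2))" if "z \<in> S" for z
      using S \<open>S \<subseteq> ball 0 1\<close> that
      by (intro Re_rotated_phi_pos) (auto simp: norm_power power_less_one_iff Im_square)
    then show ?thesis
      using D \<open>S \<subseteq> ball 0 1\<close>
      by (intro inj_on_convex_if_Re_deriv_pos[OF \<open>convex S\<close>,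
        where f = G and f' = "\<lambda>z. \<phi> (z\<^sup>2)" and c = "1 - 2 * \<i>"]) auto
  next
    assume S: "\<forall>z\<in>S. Re z * Im z \<le> 0"
    have "0 < Re ((1 + 2 * \<i>) * \<phi> (z\<^sup>2))" if "z \<in> S" for z
      using S \<open>S \<subseteq> ball 0 1\<close> that
      by (intro Re_rotated_phi_pos') (auto simp: norm_power power_less_one_iff Im_square mult.commute)
    then show ?thesis
      using D \<open>S \<subseteq> ball 0 1\<close>
      by (intro inj_on_convex_if_Re_deriv_pos[OF \<open>convex S\<close>,
        where f = G and f' = "\<lambda>z. \<phi> (z\<^sup>2)" and c = "1 + 2 * \<i>"]) auto
  qed
  have "sgn (Im z) = sgn (Im w)" "sgn (Re z) = sgn (Re w)"
    using zw sgn_Im[of z] sgn_Im[of w] sgn_Re[of z] sgn_Re[of w] by auto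
  then consider "0 \<le> Re z" "0 \<le> Re w" "0 \<le> Im z" "0 \<le> Im w"
    | "0 \<le> Re z" "0 \<le> Re w" "Im z \<le> 0" "Im w \<le> 0"
    | "Re z \<le> 0" "Re w \<le> 0" "0 \<le> Im z" "0 \<le> Im w"
    | "Re z \<le> 0" "Re w \<le> 0" "Im z \<le> 0" "Im w \<le> 0"
    by (auto simp: sgn_if split: if_splits)
  then show "z = w"
  proof cases
    case 1
    have "inj_on G (ball 0 1 \<inter> ({z. 0 \<le> Re z} \<inter> {z. 0 \<le> Im z}))"
      by (rule inj) (auto intro!: convex_Int convex_halfspace_Im_ge convex_halfspace_Re_ge)
    then show ?thesis
      using zw 1 by (auto dest: inj_onD)
  next
    case 2
    have "inj_on G (ball 0 1 \<inter> ({z. 0 \<le> Re z} \<inter> {z. Im z \<le> 0}))"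
      by (rule inj) (auto intro!: convex_Int convex_halfspace_Im_le convex_halfspace_Re_ge
        simp: mult_le_0_iff)
    then show ?thesis
      using zw 2 by (auto dest: inj_onD)
  next
    case 3
    have "inj_on G (ball 0 1 \<inter> ({z. Re z \<le> 0} \<inter> {z. 0 \<le> Im z}))"
      by (rule inj) (auto intro!: convex_Int convex_halfspace_Im_ge convex_halfspace_Re_le
        simp: mult_le_0_iff)
    then show ?thesis
      using zw 3 by (auto dest: inj_onD)
  next
    case 4
    have "inj_on G (ball 0 1 \<inter> ({z. Re z \<le> 0} \<inter> {z. Im z \<le> 0}))"
      by (rule inj) (auto intro!: convex_Int convex_halfspace_Im_le convex_halfspace_Re_le
        simp: zero_le_mult_iff)
    then show ?thesis
      using zw 4 by (auto dest: inj_onD)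
  qed
qed

section \<open>The sharp bounds\<close>

text \<open>
  The primitive \<open>f\<close> of \<open>\<phi> \<circ> \<omega>\<close> with \<open>f 0 = 0\<close> has \<open>f' 0 = \<phi> 0 = 1\<close>, so univalence is all that
  is left to check for membership in the class.
\<close>

lemma class_P_star_witness:
  assumes \<omega>: "schwarz_function \<omega>"
    and inj: "\<And>F. \<lbrakk>\<And>z. norm z < 1 \<Longrightarrow> (F has_field_derivative \<phi> (\<omega> z)) (at z); F 0 = 0\<rbrakk>
      \<Longrightarrow> inj_on F (ball 0 1)"
  obtains f where "f \<in> class_P_star" "\<And>z. norm z < 1 \<Longrightarrow> deriv f z = \<phi> (\<omega> z)"
proof -
  let ?D = "ball (0::complex) 1"
  have hol: "(\<lambda>z. \<phi> (\<omega> z)) holomorphic_on ?D"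
    using holomorphic_on_compose[OF _ holomorphic_phi, of \<omega> ?D] \<omega>
    by (simp add: schwarz_function_def o_def)
  obtain g where g: "\<And>z. z \<in> ?D \<Longrightarrow> (g has_field_derivative \<phi> (\<omega> z)) (at z within ?D)"
    using holomorphic_convex_primitive'[OF convex_ball open_ball hol] by blast
  define f where "f = (\<lambda>z. g z - g 0)"
  have D: "(f has_field_derivative \<phi> (\<omega> z)) (at z)" if "norm z < 1" for z
    using g[of z] that at_within_open[of z ?D]
    by (auto simp: f_def intro!: derivative_eq_intros)
  have f0: "f 0 = 0"
    by (simp add: f_def)
  have df: "deriv f z = \<phi> (\<omega> z)" if "norm z < 1" for z
    using D[OF that] by (rule DERIV_imp_deriv)
  have hf: "f holomorphic_on ?D"
    unfolding holomorphic_on_open[OF open_ball] using D by (metis mem_ball_0)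
  have "\<omega> 0 = 0"
    using \<omega> by (simp add: schwarz_function_def)
  then have "deriv f 0 = 1"
    by (simp add: df \<phi>_def)
  then have "f \<in> class_S"
    unfolding class_S_def
    using hf inj[OF D f0] f0 holomorphic_power_series[OF hf]
    by (auto intro!: exI[of _ "\<lambda>n. (deriv ^^ n) f 0 / fact n"])
  moreover have "subordinate (deriv f) (\<lambda>z. exp z * (1 + sin z))"
    unfolding subordinate_def
    using \<omega> df holomorphic_deriv[OF hf open_ball] holomorphic_phi[of ?D]
    by (auto simp: \<phi>_def[abs_def])
  ultimately show ?thesis
    using that df by (auto simp: class_P_star_def)
qed

theorem theorem3p3:
  shows "(\<forall>f\<in>class_P_star.
            - (1/2) \<le> norm (log_coeff f 2) - norm (log_coeff f 1) \<and>
            norm (log_coeff f 2) - norm (log_coeff f 1) \<le> 1/3) \<and>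
         (\<exists>f\<in>class_P_star. norm (log_coeff f 2) - norm (log_coeff f 1) = - (1/2)) \<and>
         (\<exists>f\<in>class_P_star. norm (log_coeff f 2) - norm (log_coeff f 1) = 1/3)"
proof (intro conjI)
  show "\<forall>f\<in>class_P_star.
            - (1/2) \<le> norm (log_coeff f 2) - norm (log_coeff f 1) \<and>
            norm (log_coeff f 2) - norm (log_coeff f 1) \<le> 1/3"
  proof
    fix f assume "f \<in> class_P_star"
    then obtain \<omega> where f: "f \<in> class_S" and \<omega>: "schwarz_function \<omega>"
      and sub: "\<And>z. norm z < 1 \<Longrightarrow> deriv f z = \<phi> (\<omega> z)"
      by (auto simp: class_P_star_def subordinate_def \<phi>_def)
    have coeffs: "log_coeff f 1 = deriv \<omega> 0 / 2" "log_coeff f 2 = deriv (deriv \<omega>) 0 / 6"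
      using log_coeffs_eq[OF f \<omega> sub] by simp_all
    have "norm (log_coeff f 1) = norm (deriv \<omega> 0) / 2"
      "norm (log_coeff f 2) = norm (deriv (deriv \<omega>) 0) / 6"
      unfolding coeffs by (simp_all add: norm_divide)
    moreover have "norm (deriv \<omega> 0) \<le> 1" "norm (deriv (deriv \<omega>) 0) \<le> 2"
      using schwarz_coefficient_bound[OF \<omega>, of 1] schwarz_coefficient_bound[OF \<omega>, of 2]
      by (auto simp: numeral_2_eq_2)
    ultimately show "- (1/2) \<le> norm (log_coeff f 2) - norm (log_coeff f 1) \<and>
            norm (log_coeff f 2) - norm (log_coeff f 1) \<le> 1/3"
      using norm_ge_zero[of "deriv \<omega> 0"] norm_ge_zero[of "deriv (deriv \<omega>) 0"] by argo
  qed
next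
  have \<omega>: "schwarz_function (\<lambda>z. z)"
    by (auto simp: schwarz_function_def)
  then obtain f where f: "f \<in> class_P_star" "\<And>z. norm z < 1 \<Longrightarrow> deriv f z = \<phi> z"
    using class_P_star_witness[OF _ inj_on_primitive_phi, of "\<lambda>z. z"] by blast
  then have "f \<in> class_S"
    by (simp add: class_P_star_def)
  then have coeffs: "log_coeff f 1 = 1 / 2" "log_coeff f 2 = 0"
    using log_coeffs_eq[OF _ \<omega> f(2)] by simp_all
  have "norm (log_coeff f 2) - norm (log_coeff f 1) = - (1/2)"
    unfolding coeffs by (simp add: norm_divide)
  then show "\<exists>f\<in>class_P_star. norm (log_coeff f 2) - norm (log_coeff f 1) = - (1/2)"
    using f(1) by blast
next
  have \<omega>: "schwarz_function (\<lambda>z. z\<^sup>2)"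
    by (auto simp: schwarz_function_def norm_power power_less_one_iff intro!: holomorphic_intros)
  then obtain f where f: "f \<in> class_P_star" "\<And>z. norm z < 1 \<Longrightarrow> deriv f z = \<phi> (z\<^sup>2)"
    using class_P_star_witness[OF _ inj_on_primitive_phi_square, of "\<lambda>z. z\<^sup>2"] by blast
  then have "f \<in> class_S"
    by (simp add: class_P_star_def)
  moreover have "deriv (\<lambda>z::complex. z\<^sup>2) = (\<lambda>z. 2 * z)"
    by (intro ext DERIV_imp_deriv) (auto intro!: derivative_eq_intros)
  ultimately have coeffs: "log_coeff f 1 = 0" "log_coeff f 2 = 1 / 3"
    using log_coeffs_eq[OF _ \<omega> f(2)] by simp_all
  have "norm (log_coeff f 2) - norm (log_coeff f 1) = 1/3"
    unfolding coeffs by (simp add: norm_divide)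
  then show "\<exists>f\<in>class_P_star. norm (log_coeff f 2) - norm (log_coeff f 1) = 1/3"
    using f(1) by blast
qed

end
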